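(* Let $A$ be a left brace such that $A^3 = \{0\}$. Suppose that $A$ is generated, as a left brace, by the element $a$ (that is, $A=\mathbf{br}(\{a\})$), and put $a_1 = a$, $a_2 = a * a = a_1 * a$, $a_3 = a_2 * a$. Then every element of $A$ has the form $k_1a_1 + k_2a_2 + k_3a_3$, where $k_1,k_2,k_3$ are integers. Moreover, if $x = k_1a_1 + k_2a_2 + k_3a_3$ and $y = t_1a_1 + t_2a_2 + t_3a_3$ are elements of $A$ with $k_1,k_2,k_3,t_1,t_2,t_3\in\mathbb{Z}$, then $$x * y = t_1k_1a_2 + \tfrac12(2k_2 + k_1 - k_1^2)t_1a_3$$ and $$xy = (k_1 + t_1)a_1 + (k_2 + t_2 + t_1k_1)a_2 + \bigl(k_3 + t_3 + \tfrac12(2k_2 + k_1 - k_1^2)t_1\bigr)a_3.$$ In particular, if $a_3 = 0$, then every element of $A$ has the form $k_1a_1 + k_2a_2$ with $k_1,k_2$ integers, and moreover, if $x = k_1a_1 + k_2a_2$, $y = t_1a_1 + t_2a_2$ are elements of $A$ with $k_1,k_2,t_1,t_2\in\mathbb{Z}$, then $$x * y = t_1k_1a_2 \quad\text{and}\quad xy = (k_1 + t_1)a_1 + (k_2 + t_2 + t_1k_1)a_2.$$ Furthermore, $A$ is nilpotent in the sense of Smoktunowicz. More precisely, $A\in\mathcal{N}_S(3,3)$ whenever $a_3 = 0$, and $A\in\mathcal{N}_S(4,3)$ whenever $a_3\neq 0$.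
   Context: A left brace is a set $A$ with two binary operations $+$ and $\cdot$ such that $(A,+)$ is an abelian group, $(A,\cdot)$ is a group, and $a(b+c) = ab + ac - a$ for all $a,b,c\in A$. For $a,b\in A$ put $a*b = ab - a - b$. A subbrace of $A$ is a subset that is a subgroup of both the additive and the multiplicative group of $A$. For a subset $M\subseteq A$, $\mathbf{br}(M)$ denotes the smallest subbrace of $A$ containing $M$ (the subbrace generated by $M$). For subbraces $K,L$ of $A$, $K*L$ denotes the subgroup of $(A,+)$ generated by all elements $x*y$ with $x\in K$, $y\in L$. Put $A^{(1)}=A$, $A^{(n+1)} = A^{(n)}*A$, and $A^1 = A$, $A^{k+1} = A*A^k$ for positive integers $n,k$; in particular $A^2=A^{(2)}=A*A$ and $A^3 = A*(A*A)$. $A$ is nilpotent in the sense of Smoktunowicz if there are positive integers $n,k$ with $A^{(n)} = \{0\} = A^k$. $\mathcal{N}_S(n,k)$ denotes the class of left braces $A$ satisfying $A^{(n)}=\{0\}=A^k$, where $n,k$ are the least integers with this property.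
   Formalization: Membership in N_S(3,3) when a_3 = 0 is claimed only if also a_2 ≠ 0 (if a_2 = 0 then A*A = {0} and A is in N_S(2,2) or N_S(1,1)); for a_3 = 0 in general, A^(3) = {0} = A^3 is stated. *)

theory Defs
  imports "HOL-Algebra.Algebra"
begin

(* The two identities are separate record fields; the axioms force zero = one. *)
locale left_brace = abelian_group A + group A for A (structure) +
  assumes brace_distrib:
    "\<lbrakk>x \<in> carrier A; y \<in> carrier A; z \<in> carrier A\<rbrakk>
      \<Longrightarrow> x \<otimes> (y \<oplus> z) = x \<otimes> y \<oplus> x \<otimes> z \<ominus> x"

definition brace_star :: "('a, 'b) ring_scheme \<Rightarrow> 'a \<Rightarrow> 'a \<Rightarrow> 'a" (infixl "\<star>\<index>" 70)
  where "x \<star>\<^bsub>A\<^esub> y = x \<otimes>\<^bsub>A\<^esub> y \<ominus>\<^bsub>A\<^esub> x \<ominus>\<^bsub>A\<^esub> y"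

definition subbrace :: "'a set \<Rightarrow> ('a, 'b) ring_scheme \<Rightarrow> bool"
  where "subbrace K A \<longleftrightarrow> subgroup K (add_monoid A) \<and> subgroup K A"

definition br :: "('a, 'b) ring_scheme \<Rightarrow> 'a set \<Rightarrow> 'a set"
  where "br A M = \<Inter> {K. subbrace K A \<and> M \<subseteq> K}"

definition set_star :: "('a, 'b) ring_scheme \<Rightarrow> 'a set \<Rightarrow> 'a set \<Rightarrow> 'a set"
  where "set_star A K L = generate (add_monoid A) {x \<star>\<^bsub>A\<^esub> y | x y. x \<in> K \<and> y \<in> L}"

(* Both series are indexed from 1; the value at index 0 is a dummy. *)
fun right_series :: "('a, 'b) ring_scheme \<Rightarrow> nat \<Rightarrow> 'a set"
  where
    "right_series A 0 = carrier A"
  | "right_series A (Suc 0) = carrier A"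
  | "right_series A (Suc (Suc n)) = set_star A (right_series A (Suc n)) (carrier A)"

fun left_series :: "('a, 'b) ring_scheme \<Rightarrow> nat \<Rightarrow> 'a set"
  where
    "left_series A 0 = carrier A"
  | "left_series A (Suc 0) = carrier A"
  | "left_series A (Suc (Suc n)) = set_star A (carrier A) (left_series A (Suc n))"

definition smoktunowicz_nilpotent :: "('a, 'b) ring_scheme \<Rightarrow> bool"
  where "smoktunowicz_nilpotent A \<longleftrightarrow>
    (\<exists>n k. 0 < n \<and> 0 < k \<and> right_series A n = {\<zero>\<^bsub>A\<^esub>} \<and> left_series A k = {\<zero>\<^bsub>A\<^esub>})"

definition smoktunowicz_class :: "nat \<Rightarrow> nat \<Rightarrow> ('a, 'b) ring_scheme set" ("\<N>\<^sub>S")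
  where "\<N>\<^sub>S n k = {A. left_brace A \<and>
    0 < n \<and> right_series A n = {\<zero>\<^bsub>A\<^esub>} \<and> (\<forall>m. 0 < m \<and> m < n \<longrightarrow> right_series A m \<noteq> {\<zero>\<^bsub>A\<^esub>}) \<and>
    0 < k \<and> left_series A k = {\<zero>\<^bsub>A\<^esub>} \<and> (\<forall>m. 0 < m \<and> m < k \<longrightarrow> left_series A m \<noteq> {\<zero>\<^bsub>A\<^esub>})}"

lemma (in left_brace) subbrace_carrier: "subbrace (carrier A) A"
  unfolding subbrace_def by (simp add: subgroup_self add.subgroup_self)

lemma (in left_brace) subbrace_br:
  assumes "M \<subseteq> carrier A"
  shows "subbrace (br A M) A"
proof -
  let ?S = "{K. subbrace K A \<and> M \<subseteq> K}"
  have "?S \<noteq> {}" using assms subbrace_carrier by blast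
  then have "subgroup (\<Inter> ?S) A" "subgroup (\<Inter> ?S) (add_monoid A)"
    by (auto intro!: subgroups_Inter add.subgroups_Inter simp: subbrace_def)
  then show ?thesis by (simp add: subbrace_def br_def)
qed

lemma br_least: "\<lbrakk>subbrace K A; M \<subseteq> K\<rbrakk> \<Longrightarrow> br A M \<subseteq> K"
  by (auto simp: br_def)

lemma left_series_3: "left_series A 3 = set_star A (carrier A) (set_star A (carrier A) (carrier A))"
  by (simp add: numeral_3_eq_3)

(* Hence "div 2" is exact on this expression. *)
lemma coefficient_even: "even (2 * l + k - k\<^sup>2)" for k l :: int
  by simp

(* The condition "star a a nonzero" cannot be dropped when claiming membership in the
   class with indices 3, 3: if star vanishes identically, both series are zero at index 2. *)
lemma trivial_star_not_class_3_3:
  assumes "left_brace A" and star0: "\<And>x y. \<lbrakk>x \<in> carrier A; y \<in> carrier A\<rbrakk> \<Longrightarrow> x \<star>\<^bsub>A\<^esub> y = \<zero>\<^bsub>A\<^esub>"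
  shows "A \<notin> \<N>\<^sub>S 3 3"
proof -
  interpret left_brace A by fact
  have "{x \<star>\<^bsub>A\<^esub> y | x y. x \<in> carrier A \<and> y \<in> carrier A} = {\<zero>\<^bsub>A\<^esub>}"
    using star0 by force
  moreover have "generate (add_monoid A) {\<zero>\<^bsub>A\<^esub>} = {\<zero>\<^bsub>A\<^esub>}"
    using add.generate_one by simp
  ultimately have "right_series A 2 = {\<zero>\<^bsub>A\<^esub>}"
    by (simp add: numeral_2_eq_2 set_star_def)
  then show ?thesis by (force simp: smoktunowicz_class_def)
qed

end

theory Submission
  imports Defs
begin

text \<open>
  The identity \<open>(x \<otimes> y) \<star> z = x \<star> z \<oplus> y \<star> z \<oplus> x \<star> (y \<star> z)\<close> holds in every left brace. If
  \<open>A * (A * A)\<close> vanishes, it makes \<open>\<star>\<close> a bilinear map on \<open>(A, \<otimes>) \<times> (A, \<oplus>)\<close>. Expanding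
  \<open>x \<otimes> y = x \<oplus> y \<oplus> x \<star> y\<close> on the left and comparing with the same expansion for \<open>y\<close>, \<open>x\<close> shows
  \<open>(x \<star> y) \<star> w = (y \<star> x) \<star> w\<close>; with \<open>x\<close> itself a star product the right-hand side is zero,
  so \<open>((x \<star> y) \<star> z) \<star> w = \<zero>\<close> and in particular \<open>a3 \<star> a = \<zero>\<close>. The quadratic coefficient arises
  from \<open>((k + 1) a) \<star> a = (k a) \<star> a \<oplus> a2 \<ominus> k a3\<close>. The resulting product formula shows that the
  integer combinations of \<open>a1\<close>, \<open>a2\<close>, \<open>a3\<close> form a subbrace, which must be all of \<open>A\<close>.
\<close>

section \<open>Integer-indexed sequences in an abelian group\<close>

context abelian_group
begin

text \<open>Induction runs both ways from 0: the shared increments \<open>g\<close> carry equality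
  upwards, and cancelling them carries it downwards. Identities for integer multiples then need no
  case split on the sign.\<close>

lemma int_seq_eqI:
  fixes f h :: "int \<Rightarrow> 'a"
  assumes closed: "\<And>k. f k \<in> carrier G" "\<And>k. h k \<in> carrier G" "\<And>k. g k \<in> carrier G"
    and zero: "f 0 = h 0"
    and f: "\<And>k. f (k + 1) = f k \<oplus> g k"
    and h: "\<And>k. h (k + 1) = h k \<oplus> g k"
  shows "f k = h k"
proof (induction k rule: int_induct[where k = 0])
  case base
  show ?case by (rule zero)
next
  case (step1 i)
  then show ?case by (simp add: f h)
next
  case (step2 i)
  have "f (i - 1) \<oplus> g (i - 1) = h (i - 1) \<oplus> g (i - 1)"
    using f[of "i - 1"] h[of "i - 1"] step2 by simp
  then show ?case by (simp add: closed)
qed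

lemma add_pow_int_0 [simp]: "add_pow G (0::int) x = \<zero>"
  by (simp add: add_pow_def)

lemma add_eq_minusD: "\<lbrakk>x \<in> carrier G; y \<in> carrier G; x \<oplus> y = z\<rbrakk> \<Longrightarrow> x = z \<ominus> y"
  by (auto simp: minus_eq a_assoc r_neg)

end

section \<open>The star operation in an arbitrary left brace\<close>

context left_brace
begin

text \<open>Distributivity at \<open>\<one>\<close>, \<open>\<zero>\<close>, \<open>\<zero>\<close>
  reads \<open>\<zero> = \<zero> \<oplus> \<zero> \<ominus> \<one>\<close>.\<close>

lemma one_eq_zero: "\<one> = \<zero>"
proof -
  have "\<zero> = \<one> \<otimes> (\<zero> \<oplus> \<zero>)" by simp
  also have "\<dots> = \<one> \<otimes> \<zero> \<oplus> \<one> \<otimes> \<zero> \<ominus> \<one>" by (rule brace_distrib) auto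
  finally have "\<zero> = \<ominus> \<one>" by (simp add: minus_eq)
  then have "\<one> \<oplus> \<zero> = \<zero>" using r_neg[of \<one>] by simp
  then show ?thesis by simp
qed

lemma star_closed [simp, intro]: "\<lbrakk>x \<in> carrier A; y \<in> carrier A\<rbrakk> \<Longrightarrow> x \<star> y \<in> carrier A"
  by (simp add: brace_star_def)

lemma mult_eq:
  assumes "x \<in> carrier A" "y \<in> carrier A"
  shows "x \<otimes> y = x \<oplus> y \<oplus> x \<star> y"
proof -
  have "x \<oplus> y \<oplus> x \<star> y = x \<otimes> y \<oplus> (x \<oplus> \<ominus> x) \<oplus> (y \<oplus> \<ominus> y)"
    using assms by (simp add: brace_star_def minus_eq a_ac)
  then show ?thesis using assms by (simp add: r_neg)
qed

lemma star_eqI: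
  assumes "x \<in> carrier A" "y \<in> carrier A" "z \<in> carrier A" and eq: "x \<otimes> y = x \<oplus> y \<oplus> z"
  shows "x \<star> y = z"
proof -
  have "x \<oplus> y \<oplus> x \<star> y = x \<oplus> y \<oplus> z" using assms(1,2) eq by (simp only: mult_eq)
  then show ?thesis using assms(1-3) by (simp only: add.l_cancel star_closed a_closed)
qed

lemma star_zero_right [simp]: "x \<in> carrier A \<Longrightarrow> x \<star> \<zero> = \<zero>"
  by (rule star_eqI) (simp_all add: r_one[unfolded one_eq_zero])

text \<open>Expanding both products leaves two copies of \<open>x\<close>; the
  \<open>\<ominus> x\<close> of the brace law cancels the surplus one.\<close>

lemma star_add_right:
  assumes "x \<in> carrier A" "y \<in> carrier A" "z \<in> carrier A"
  shows "x \<star> (y \<oplus> z) = x \<star> y \<oplus> x \<star> z"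
proof (rule star_eqI)
  show "x \<otimes> (y \<oplus> z) = x \<oplus> (y \<oplus> z) \<oplus> (x \<star> y \<oplus> x \<star> z)"
  proof -
    have "x \<otimes> (y \<oplus> z) = x \<oplus> (y \<oplus> z) \<oplus> (x \<star> y \<oplus> x \<star> z) \<oplus> (x \<oplus> \<ominus> x)"
      using assms by (simp add: brace_distrib mult_eq[of x y] mult_eq[of x z] minus_eq a_ac)
    then show ?thesis using assms by (simp add: r_neg)
  qed
qed (use assms in auto)


lemma zero_star [simp]: "x \<in> carrier A \<Longrightarrow> \<zero> \<star> x = \<zero>"
  by (rule star_eqI) (simp_all add: l_one[unfolded one_eq_zero])

text \<open>This is associativity in disguise: \<open>x \<otimes> (y \<otimes> z)\<close> is
  expanded by additivity on the right, and \<open>x \<otimes> y\<close> is then regrouped out of the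
  sum.\<close>

lemma star_mult_left:
  assumes "x \<in> carrier A" "y \<in> carrier A" "z \<in> carrier A"
  shows "(x \<otimes> y) \<star> z = x \<star> z \<oplus> y \<star> z \<oplus> x \<star> (y \<star> z)"
proof (rule star_eqI)
  have "x \<otimes> y \<otimes> z = x \<otimes> (y \<oplus> z \<oplus> y \<star> z)"
    using assms by (simp add: m_assoc mult_eq[of y z])
  also have "\<dots> = x \<oplus> (y \<oplus> z \<oplus> y \<star> z) \<oplus> (x \<star> y \<oplus> x \<star> z \<oplus> x \<star> (y \<star> z))"
    using assms by (simp add: mult_eq star_add_right)
  also have "\<dots> = x \<otimes> y \<oplus> z \<oplus> (x \<star> z \<oplus> y \<star> z \<oplus> x \<star> (y \<star> z))"
    using assms by (simp add: mult_eq[of x y] a_ac)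
  finally show "x \<otimes> y \<otimes> z = x \<otimes> y \<oplus> z \<oplus> (x \<star> z \<oplus> y \<star> z \<oplus> x \<star> (y \<star> z))" .
qed (use assms in auto)

lemma star_add_pow_right:
  assumes "x \<in> carrier A" "y \<in> carrier A"
  shows "x \<star> add_pow A (k::int) y = add_pow A k (x \<star> y)"
proof (rule int_seq_eqI[where g = "\<lambda>_. x \<star> y"])
  show "x \<star> add_pow A (k + 1) y = x \<star> add_pow A k y \<oplus> x \<star> y" for k :: int
    using assms by (simp add: add.int_pow_mult star_add_right)
qed (use assms in \<open>simp_all add: add.int_pow_mult\<close>)

text \<open>Inverses in the ambient group are unique, so a right inverse found inside
  \<open>K\<close> is \<open>inv x\<close>. An explicit solution of
  \<open>x \<otimes> y = \<one>\<close> therefore suffices.\<close>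

lemma subbraceI:
  assumes add: "subgroup K (add_monoid A)"
    and mult: "\<And>x y. \<lbrakk>x \<in> K; y \<in> K\<rbrakk> \<Longrightarrow> x \<otimes> y \<in> K"
    and right_inv: "\<And>x. x \<in> K \<Longrightarrow> \<exists>y \<in> K. x \<otimes> y = \<one>"
  shows "subbrace K A"
proof -
  have sub: "K \<subseteq> carrier A" using add.subgroupE(1)[OF add] by simp
  have inv: "inv x \<in> K" if "x \<in> K" for x
  proof -
    obtain y where y: "y \<in> K" "x \<otimes> y = \<one>" using right_inv[OF \<open>x \<in> K\<close>] by blast
    have "x \<in> carrier A" "y \<in> carrier A" using y that sub by auto
    then have "inv x = y" using y(2) by (intro inv_equality[OF inv_comm])
    with y(1) show ?thesis by simp
  qed
  have "\<one> \<in> K" using subgroup.one_closed[OF add] by (simp add: one_eq_zero)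
  then have "subgroup K A" by (intro subgroup.intro[OF sub] mult inv)
  with add show ?thesis by (simp add: subbrace_def)
qed

section \<open>Additive subgroups generated by star products\<close>

lemma star_in_set_star: "\<lbrakk>x \<in> K; y \<in> L\<rbrakk> \<Longrightarrow> x \<star> y \<in> set_star A K L"
  unfolding set_star_def by (rule generate.incl) blast

lemma set_star_least:
  assumes "subgroup H (add_monoid A)" "\<And>x y. \<lbrakk>x \<in> K; y \<in> L\<rbrakk> \<Longrightarrow> x \<star> y \<in> H"
  shows "set_star A K L \<subseteq> H"
  unfolding set_star_def by (rule add.generate_subgroup_incl[OF _ assms(1)]) (use assms(2) in blast)

lemma set_star_eq_zero:
  assumes "\<And>x y. \<lbrakk>x \<in> K; y \<in> L\<rbrakk> \<Longrightarrow> x \<star> y = \<zero>"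
  shows "set_star A K L = {\<zero>}"
proof
  show "set_star A K L \<subseteq> {\<zero>}"
    by (rule set_star_least[OF add.triv_subgroup]) (use assms in blast)
  show "{\<zero>} \<subseteq> set_star A K L"
    using generate.one[of "add_monoid A"] by (simp add: set_star_def)
qed

end

section \<open>Left braces in which \<open>A * (A * A)\<close> vanishes\<close>

locale left_brace_cube_zero = left_brace +
  assumes star_star: "\<lbrakk>x \<in> carrier A; y \<in> carrier A; z \<in> carrier A\<rbrakk> \<Longrightarrow> x \<star> (y \<star> z) = \<zero>"
begin

lemma star_mult: "\<lbrakk>x \<in> carrier A; y \<in> carrier A; z \<in> carrier A\<rbrakk> \<Longrightarrow> (x \<otimes> y) \<star> z = x \<star> z \<oplus> y \<star> z"
  by (simp add: star_mult_left star_star)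

text \<open>If \<open>x \<star> z = \<zero>\<close>, then \<open>x \<oplus> z = x \<otimes> z\<close>.\<close>

lemma add_star_of_star_zero:
  assumes "x \<in> carrier A" "z \<in> carrier A" "w \<in> carrier A" "x \<star> z = \<zero>"
  shows "(x \<oplus> z) \<star> w = x \<star> w \<oplus> z \<star> w"
  using assms star_mult[of x z w] mult_eq[of x z] by simp

text \<open>In \<open>x \<otimes> y = (x \<oplus> y) \<oplus> x \<star> y\<close> the last summand
  is annihilated from the left, so it splits off under \<open>\<star> w\<close>;
  \<open>star_mult\<close> evaluates the other side.\<close>

lemma add_star:
  assumes "x \<in> carrier A" "y \<in> carrier A" "w \<in> carrier A"
  shows "(x \<oplus> y) \<star> w = x \<star> w \<oplus> y \<star> w \<ominus> (x \<star> y) \<star> w"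
proof -
  have "(x \<otimes> y) \<star> w = (x \<oplus> y) \<star> w \<oplus> (x \<star> y) \<star> w"
    using assms by (simp add: mult_eq add_star_of_star_zero star_add_right star_star)
  then show ?thesis
    using assms by (intro add_eq_minusD) (simp_all add: star_mult)
qed

text \<open>Since \<open>\<oplus>\<close> commutes, expanding \<open>add_star\<close> in both orders
  leaves only the two correction terms to compare.\<close>

lemma star_star_commute:
  assumes "x \<in> carrier A" "y \<in> carrier A" "w \<in> carrier A"
  shows "(x \<star> y) \<star> w = (y \<star> x) \<star> w"
proof -
  have "x \<star> w \<oplus> y \<star> w \<ominus> (x \<star> y) \<star> w = (x \<oplus> y) \<star> w"
    using assms by (simp only: add_star)
  also have "\<dots> = (y \<oplus> x) \<star> w" using assms by (simp only: a_comm)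
  also have "\<dots> = y \<star> w \<oplus> x \<star> w \<ominus> (y \<star> x) \<star> w" using assms by (simp only: add_star)
  also have "y \<star> w \<oplus> x \<star> w = x \<star> w \<oplus> y \<star> w" using assms by (intro a_comm star_closed)
  finally show ?thesis using assms by (simp add: minus_eq inj_on_eq_iff[OF a_inv_inj])
qed

text \<open>Commuting \<open>x \<star> y\<close> with \<open>z\<close> produces
  \<open>z \<star> (x \<star> y)\<close>, which is zero.\<close>

lemma star_star_star_left:
  assumes "x \<in> carrier A" "y \<in> carrier A" "z \<in> carrier A" "w \<in> carrier A"
  shows "((x \<star> y) \<star> z) \<star> w = \<zero>"
  using assms star_star_commute[of "x \<star> y" z w] by (simp add: star_star)

text \<open>The last hypothesis gives \<open>add_pow A k z \<star> z = \<zero>\<close>, so adding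
  one more \<open>z\<close> is additive under \<open>\<star> w\<close>. It is meant for star
  products \<open>z\<close>.\<close>

lemma add_pow_star:
  assumes "z \<in> carrier A" "w \<in> carrier A" "\<And>x. x \<in> carrier A \<Longrightarrow> x \<star> z = \<zero>"
  shows "add_pow A (k::int) z \<star> w = add_pow A k (z \<star> w)"
proof (rule int_seq_eqI[where g = "\<lambda>_. z \<star> w"])
  show "add_pow A (k + 1) z \<star> w = add_pow A k z \<star> w \<oplus> z \<star> w" for k :: int
    using assms by (simp add: add.int_pow_mult add_star_of_star_zero)
qed (use assms in \<open>simp_all add: add.int_pow_mult\<close>)

text \<open>Passing from \<open>k\<close> to \<open>k + 1\<close> adds
  \<open>b \<ominus> add_pow A k c\<close>; the quadratic coefficient is the discrete antiderivative
  of \<open>- k\<close> that vanishes at 0.\<close>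

lemma add_pow_star_self:
  assumes a: "a \<in> carrier A"
  defines "b \<equiv> a \<star> a" and "c \<equiv> (a \<star> a) \<star> a"
  shows "add_pow A (k::int) a \<star> a = add_pow A k b \<oplus> add_pow A ((k - k\<^sup>2) div 2) c"
proof (rule int_seq_eqI[where g = "\<lambda>k. b \<ominus> add_pow A k c" and k = k])
  have [simp]: "b \<in> carrier A" "c \<in> carrier A" using a by (auto simp: b_def c_def)
  show "add_pow A k a \<star> a \<in> carrier A"
    "add_pow A k b \<oplus> add_pow A ((k - k\<^sup>2) div 2) c \<in> carrier A"
    "b \<ominus> add_pow A k c \<in> carrier A" for k :: int
    using a by simp_all
  show "add_pow A (0::int) a \<star> a = add_pow A (0::int) b \<oplus> add_pow A ((0 - 0\<^sup>2) div 2 :: int) c"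
    using a by simp
  fix k :: int
  \<comment> \<open>With \<open>a\<close> as first summand, the correction term of
    \<open>add_star\<close> is computable by additivity on the right. The other order would involve
    \<open>add_pow A k a \<star> a\<close>, the very value being determined.\<close>
  have "(a \<star> add_pow A k a) \<star> a = add_pow A k c"
    using a by (simp add: star_add_pow_right add_pow_star star_star c_def)
  then have step: "(a \<oplus> add_pow A k a) \<star> a = b \<oplus> add_pow A k a \<star> a \<ominus> add_pow A k c"
    using a by (simp add: add_star b_def)
  have "add_pow A (k + 1) a = a \<oplus> add_pow A k a"
    using a by (simp add: add.int_pow_mult a_comm)
  then have "add_pow A (k + 1) a \<star> a = b \<oplus> add_pow A k a \<star> a \<ominus> add_pow A k c"
    using step by simp
  then show "add_pow A (k + 1) a \<star> a = add_pow A k a \<star> a \<oplus> (b \<ominus> add_pow A k c)"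
    using a by (simp add: a_ac minus_eq)
  \<comment> \<open>The numerator changes by exactly \<open>- 2 * k\<close>, so \<open>div\<close>
    splits without a parity argument.\<close>
  have "(k + 1 - (k + 1)\<^sup>2) div 2 = (k - k\<^sup>2 + (- k) * 2) div 2"
    by (simp add: power2_eq_square algebra_simps)
  also have "\<dots> = (k - k\<^sup>2) div 2 + - k" by simp
  finally have *: "(k + 1 - (k + 1)\<^sup>2) div 2 = (k - k\<^sup>2) div 2 + - k" .
  have "add_pow A ((k - k\<^sup>2) div 2 + - k) c = add_pow A ((k - k\<^sup>2) div 2) c \<ominus> add_pow A k c"
    by (simp only: add.int_pow_mult add.int_pow_neg minus_eq \<open>c \<in> carrier A\<close>)
  moreover have "add_pow A (k + 1) b = add_pow A k b \<oplus> b" by (simp add: add.int_pow_mult)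
  ultimately show "add_pow A (k + 1) b \<oplus> add_pow A ((k + 1 - (k + 1)\<^sup>2) div 2) c =
      add_pow A k b \<oplus> add_pow A ((k - k\<^sup>2) div 2) c \<oplus> (b \<ominus> add_pow A k c)"
    unfolding * by (simp add: a_ac minus_eq)
qed

section \<open>Coefficient arithmetic for combinations of \<open>a\<close>,
  \<open>a \<star> a\<close> and \<open>(a \<star> a) \<star> a\<close>\<close>

definition comb :: "'a \<Rightarrow> int \<Rightarrow> int \<Rightarrow> int \<Rightarrow> 'a"
  where "comb a k1 k2 k3 = add_pow A k1 a \<oplus> add_pow A k2 (a \<star> a) \<oplus> add_pow A k3 ((a \<star> a) \<star> a)"

lemma comb_closed [simp]: "a \<in> carrier A \<Longrightarrow> comb a k1 k2 k3 \<in> carrier A"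
  by (simp add: comb_def)

lemma comb_add: "a \<in> carrier A \<Longrightarrow> comb a k1 k2 k3 \<oplus> comb a t1 t2 t3 = comb a (k1 + t1) (k2 + t2) (k3 + t3)"
  by (simp add: comb_def add.int_pow_mult a_ac)

text \<open>The last two summands of \<open>comb\<close> are annihilated from the left, so the left
  argument splits. The third summand contributes nothing; the last coefficient joins
  \<open>k2\<close> to the quadratic term coming from \<open>k1\<close>.\<close>

lemma comb_star_self:
  assumes "a \<in> carrier A"
  shows "comb a k1 k2 k3 \<star> a = comb a 0 k1 ((2 * k2 + k1 - k1\<^sup>2) div 2)"
proof -
  let ?b = "a \<star> a" and ?c = "(a \<star> a) \<star> a"
  have "comb a k1 k2 k3 \<star> a = add_pow A k1 a \<star> a \<oplus> add_pow A k2 ?b \<star> a \<oplus> add_pow A k3 ?c \<star> a"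
    using assms by (simp add: comb_def add_star_of_star_zero star_add_pow_right star_star)
  also have "add_pow A k3 ?c \<star> a = \<zero>"
    using assms by (simp add: add_pow_star star_star star_star_star_left)
  also have "add_pow A k2 ?b \<star> a = add_pow A k2 ?c"
    using assms by (simp add: add_pow_star star_star)
  finally have "comb a k1 k2 k3 \<star> a = add_pow A k1 ?b \<oplus> add_pow A ((k1 - k1\<^sup>2) div 2) ?c \<oplus> add_pow A k2 ?c"
    using assms by (simp add: add_pow_star_self)
  moreover have "(2 * k2 + k1 - k1\<^sup>2) div 2 = (k1 - k1\<^sup>2) div 2 + k2"
  proof -
    have "2 * k2 + k1 - k1\<^sup>2 = k1 - k1\<^sup>2 + k2 * 2" by simp
    then show ?thesis by simp
  qed
  ultimately show ?thesis
    using assms by (simp add: comb_def add.int_pow_mult a_assoc)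
qed

text \<open>Of the right argument only \<open>add_pow A t1 a\<close> survives, the other summands
  being multiples of star products.\<close>

lemma comb_star_comb:
  assumes "a \<in> carrier A"
  shows "comb a k1 k2 k3 \<star> comb a t1 t2 t3 = comb a 0 (t1 * k1) ((2 * k2 + k1 - k1\<^sup>2) div 2 * t1)"
proof -
  let ?x = "comb a k1 k2 k3"
  have "?x \<star> comb a t1 t2 t3 = add_pow A t1 (?x \<star> a)"
    using assms by (simp add: comb_def[of a t1] star_add_right star_add_pow_right star_star)
  then show ?thesis
    using assms by (simp add: comb_star_self)
      (simp add: comb_def add.int_pow_distrib add.int_pow_pow mult.commute)
qed

lemma comb_mult_comb:
  "a \<in> carrier A \<Longrightarrow> comb a k1 k2 k3 \<otimes> comb a t1 t2 t3
    = comb a (k1 + t1) (k2 + t2 + t1 * k1) (k3 + t3 + (2 * k2 + k1 - k1\<^sup>2) div 2 * t1)"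
  by (simp add: mult_eq comb_add comb_star_comb)

text \<open>The factors \<open>d\<close> and \<open>e\<close> are switches: with values 0 or 1 they
  yield the full span and the smaller spans that bound the right series.\<close>

lemma subgroup_combs:
  assumes "a \<in> carrier A"
  shows "subgroup {comb a (d * k1) (e * k2) k3 | k1 k2 k3. True} (add_monoid A)" (is "subgroup ?H _")
proof (rule add.subgroupI)
  show "?H \<subseteq> carrier A" "?H \<noteq> {}" using assms by auto
next
  fix x assume "x \<in> ?H"
  then obtain k1 k2 k3 where x: "x = comb a (d * k1) (e * k2) k3" by blast
  have "comb a (d * - k1) (e * - k2) (- k3) \<oplus> x = comb a 0 0 0"
    using assms by (simp add: x comb_add)
  then have "comb a (d * - k1) (e * - k2) (- k3) \<oplus> x = \<zero>"
    using assms by (simp add: comb_def)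
  then have "\<ominus> x = comb a (d * - k1) (e * - k2) (- k3)"
    using assms x by (intro minus_equality) simp_all
  then show "\<ominus> x \<in> ?H" by blast
next
  fix x y assume "x \<in> ?H" "y \<in> ?H"
  then obtain k1 k2 k3 t1 t2 t3
    where "x = comb a (d * k1) (e * k2) k3" "y = comb a (d * t1) (e * t2) t3" by blast
  then have "x \<oplus> y = comb a (d * (k1 + t1)) (e * (k2 + t2)) (k3 + t3)"
    using assms by (simp add: comb_add distrib_left)
  then show "x \<oplus> y \<in> ?H" by blast
qed

lemma subbrace_combs:
  assumes "a \<in> carrier A"
  shows "subbrace {comb a k1 k2 k3 | k1 k2 k3. True} A" (is "subbrace ?H _")
proof (rule subbraceI)
  show "subgroup ?H (add_monoid A)" using subgroup_combs[OF assms, of 1 1] by simp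
next
  fix x assume "x \<in> ?H"
  then obtain k1 k2 k3 where x: "x = comb a k1 k2 k3" by blast
  let ?q = "(2 * k2 + k1 - k1\<^sup>2) div 2"
  \<comment> \<open>The witness comes from setting the three coefficients of the product formula to
    zero and solving for \<open>t1\<close>, \<open>t2\<close>, \<open>t3\<close> in that
    order.\<close>
  have "x \<otimes> comb a (- k1) (k1 * k1 - k2) (?q * k1 - k3) = comb a 0 0 0"
    using assms by (simp add: x comb_mult_comb)
  then have "x \<otimes> comb a (- k1) (k1 * k1 - k2) (?q * k1 - k3) = \<one>"
    using assms by (simp add: comb_def one_eq_zero)
  then show "\<exists>y \<in> ?H. x \<otimes> y = \<one>" by blast
next
  fix x y assume "x \<in> ?H" "y \<in> ?H"
  then obtain k1 k2 k3 t1 t2 t3 where "x = comb a k1 k2 k3" "y = comb a t1 t2 t3" by blast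
  then have "x \<otimes> y = comb a (k1 + t1) (k2 + t2 + t1 * k1) (k3 + t3 + (2 * k2 + k1 - k1\<^sup>2) div 2 * t1)"
    using assms by (simp add: comb_mult_comb)
  then show "x \<otimes> y \<in> ?H" by blast
qed

text \<open>The combinations form a subbrace containing \<open>a\<close>, and
  \<open>br A {a}\<close> is the least such subbrace.\<close>

lemma generated_eq_comb:
  assumes "a \<in> carrier A" "carrier A = br A {a}" "x \<in> carrier A"
  obtains k1 k2 k3 where "x = comb a k1 k2 k3"
proof -
  have "a = comb a 1 0 0" using assms(1) by (simp add: comb_def)
  then have "{a} \<subseteq> {comb a k1 k2 k3 | k1 k2 k3. True}" by blast
  with subbrace_combs[OF assms(1)] have "br A {a} \<subseteq> {comb a k1 k2 k3 | k1 k2 k3. True}"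
    by (rule br_least)
  then have "x \<in> {comb a k1 k2 k3 | k1 k2 k3. True}" using assms(2,3) by auto
  then show thesis using that by blast
qed

section \<open>Upper bounds for the right series\<close>

lemma right_series_2_subset:
  assumes "a \<in> carrier A" "carrier A = br A {a}"
  shows "right_series A 2 \<subseteq> {comb a 0 k2 k3 | k2 k3. True}"
proof -
  have "x \<star> y \<in> {comb a 0 k2 k3 | k2 k3. True}" if xy: "x \<in> carrier A" "y \<in> carrier A" for x y
  proof -
    obtain k1 k2 k3 where "x = comb a k1 k2 k3" by (rule generated_eq_comb[OF assms xy(1)])
    moreover obtain t1 t2 t3 where "y = comb a t1 t2 t3" by (rule generated_eq_comb[OF assms xy(2)])
    ultimately have "x \<star> y = comb a 0 (t1 * k1) ((2 * k2 + k1 - k1\<^sup>2) div 2 * t1)"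
      using assms(1) by (simp only: comb_star_comb)
    then show ?thesis by blast
  qed
  then have "set_star A (carrier A) (carrier A) \<subseteq> {comb a 0 k2 k3 | k2 k3. True}"
    using subgroup_combs[OF assms(1), of 0 1] by (intro set_star_least) simp_all
  then show ?thesis by (simp add: numeral_2_eq_2)
qed

lemma right_series_3_subset:
  assumes "a \<in> carrier A" "carrier A = br A {a}"
  shows "right_series A 3 \<subseteq> {comb a 0 0 k | k. True}"
proof -
  have "x \<star> y \<in> {comb a 0 0 k | k. True}" if xy: "x \<in> right_series A 2" "y \<in> carrier A" for x y
  proof -
    obtain k2 k3 where "x = comb a 0 k2 k3" using right_series_2_subset[OF assms] xy(1) by blast
    moreover obtain t1 t2 t3 where "y = comb a t1 t2 t3" by (rule generated_eq_comb[OF assms xy(2)])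
    \<comment> \<open>A vanishing first coefficient on the left removes the
      \<open>a \<star> a\<close> term and reduces the quotient to \<open>k2\<close>.\<close>
    ultimately have "x \<star> y = comb a 0 0 (k2 * t1)"
      using assms(1) by (simp add: comb_star_comb)
    then show ?thesis by blast
  qed
  then have "set_star A (right_series A 2) (carrier A) \<subseteq> {comb a 0 0 k | k. True}"
    using subgroup_combs[OF assms(1), of 0 0] by (intro set_star_least) simp_all
  then show ?thesis by (simp add: numeral_2_eq_2 numeral_3_eq_3)
qed

text \<open>The star formula involves only the first two coefficients of its left argument, and both
  are zero on the third term of the series.\<close>

lemma right_series_4_eq_zero:
  assumes "a \<in> carrier A" "carrier A = br A {a}"
  shows "right_series A 4 = {\<zero>}"
proof -
  have "x \<star> y = \<zero>" if xy: "x \<in> right_series A 3" "y \<in> carrier A" for x y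
  proof -
    obtain k where "x = comb a 0 0 k" using right_series_3_subset[OF assms] xy(1) by blast
    moreover obtain t1 t2 t3 where "y = comb a t1 t2 t3" by (rule generated_eq_comb[OF assms xy(2)])
    ultimately have "x \<star> y = comb a 0 0 0"
      using assms(1) by (simp add: comb_star_comb)
    then show ?thesis using assms(1) by (simp add: comb_def)
  qed
  then have "set_star A (right_series A 3) (carrier A) = {\<zero>}" by (rule set_star_eq_zero)
  then show ?thesis by (simp add: numeral_3_eq_3 eval_nat_numeral)
qed

end

section \<open>Explicit formulas and exact nilpotency indices\<close>

theorem theoremA:
  fixes A :: "('a, 'b) ring_scheme" (structure)
    and a a1 a2 a3 :: 'a
  assumes brace: "left_brace A"
    and A3: "left_series A 3 = {\<zero>}"
    and a: "a \<in> carrier A"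
    and gen: "carrier A = br A {a}"
    and a1: "a1 = a"
    and a2: "a2 = a \<star> a"
    and a3: "a3 = a2 \<star> a"
  shows
    "(\<forall>x \<in> carrier A. \<exists>(k1::int) (k2::int) (k3::int). x = add_pow A k1 a1 \<oplus> add_pow A k2 a2 \<oplus> add_pow A k3 a3)
   \<and> (\<forall>x \<in> carrier A. \<forall>y \<in> carrier A. \<forall>(k1::int) (k2::int) (k3::int) (t1::int) (t2::int) (t3::int).
        x = add_pow A k1 a1 \<oplus> add_pow A k2 a2 \<oplus> add_pow A k3 a3 \<longrightarrow>
        y = add_pow A t1 a1 \<oplus> add_pow A t2 a2 \<oplus> add_pow A t3 a3 \<longrightarrow>
          x \<star> y = add_pow A (t1 * k1) a2 \<oplus> add_pow A (((2 * k2 + k1 - k1\<^sup>2) div 2) * t1) a3 \<and>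
          x \<otimes> y = add_pow A (k1 + t1) a1 \<oplus> add_pow A (k2 + t2 + t1 * k1) a2
                    \<oplus> add_pow A (k3 + t3 + ((2 * k2 + k1 - k1\<^sup>2) div 2) * t1) a3)
   \<and> (a3 = \<zero> \<longrightarrow>
        (\<forall>x \<in> carrier A. \<exists>(k1::int) (k2::int). x = add_pow A k1 a1 \<oplus> add_pow A k2 a2) \<and>
        (\<forall>x \<in> carrier A. \<forall>y \<in> carrier A. \<forall>(k1::int) (k2::int) (t1::int) (t2::int).
          x = add_pow A k1 a1 \<oplus> add_pow A k2 a2 \<longrightarrow>
          y = add_pow A t1 a1 \<oplus> add_pow A t2 a2 \<longrightarrow>
            x \<star> y = add_pow A (t1 * k1) a2 \<and>
            x \<otimes> y = add_pow A (k1 + t1) a1 \<oplus> add_pow A (k2 + t2 + t1 * k1) a2))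
   \<and> smoktunowicz_nilpotent A
   \<and> (a3 = \<zero> \<longrightarrow> right_series A 3 = {\<zero>} \<and> left_series A 3 = {\<zero>})
   \<and> (a3 = \<zero> \<and> a2 \<noteq> \<zero> \<longrightarrow> A \<in> \<N>\<^sub>S 3 3)
   \<and> (a3 \<noteq> \<zero> \<longrightarrow> A \<in> \<N>\<^sub>S 4 3)"
proof -
  interpret left_brace A by (rule brace)
  have zero3: "set_star A (carrier A) (set_star A (carrier A) (carrier A)) = {\<zero>}"
    using A3 by (simp only: left_series_3)
  \<comment> \<open>Each element \<open>x \<star> (y \<star> z)\<close> lies in the subgroup that
    \<open>zero3\<close> makes trivial.\<close>
  interpret left_brace_cube_zero A
  proof
    fix x y z assume "x \<in> carrier A" "y \<in> carrier A" "z \<in> carrier A"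
    then have "x \<star> (y \<star> z) \<in> set_star A (carrier A) (set_star A (carrier A) (carrier A))"
      by (intro star_in_set_star)
    then show "x \<star> (y \<star> z) = \<zero>" by (simp add: zero3)
  qed
  have comb3: "add_pow A k1 a1 \<oplus> add_pow A k2 a2 \<oplus> add_pow A k3 a3 = comb a k1 k2 k3"
    for k1 k2 k3 :: int
    by (simp only: comb_def a1 a2 a3)
  have span: "\<exists>k1 k2 k3. x = comb a k1 k2 k3" if "x \<in> carrier A" for x
    using generated_eq_comb[OF a gen that] by metis
  have closed: "a1 \<in> carrier A" "a2 \<in> carrier A" "a3 \<in> carrier A"
    using a by (simp_all add: a1 a2 a3)
  have comb0: "add_pow A k2 a2 \<oplus> add_pow A k3 a3 = comb a 0 k2 k3" for k2 k3 :: int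
    using closed by (simp add: comb3[symmetric])
  have comb2: "comb a k1 k2 k3 = add_pow A k1 a1 \<oplus> add_pow A k2 a2" if "a3 = \<zero>" for k1 k2 k3
    using closed by (simp add: comb3[symmetric] that)
  have right3: "right_series A 3 = {\<zero>}" if "a3 = \<zero>"
  proof
    show "right_series A 3 \<subseteq> {\<zero>}"
      using right_series_3_subset[OF a gen] closed by (auto simp: comb2[OF that])
    show "{\<zero>} \<subseteq> right_series A 3"
      using generate.one[of "add_monoid A"] by (simp add: numeral_3_eq_3 set_star_def)
  qed
  have right4: "right_series A 4 = {\<zero>}" by (rule right_series_4_eq_zero[OF a gen])
  \<comment> \<open>These members witness that the early terms of both series are non-zero, which
    gives minimality of the indices.\<close>
  have mem: "a \<in> right_series A 1" "a2 \<in> right_series A 2" "a3 \<in> right_series A 3"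
    "a \<in> left_series A 1" "a2 \<in> left_series A 2"
    using a by (simp_all add: a2 a3 numeral_2_eq_2 numeral_3_eq_3 star_in_set_star)
  \<comment> \<open>Since \<open>\<zero> \<star> a = \<zero>\<close>, non-vanishing passes from
    \<open>a3\<close> to \<open>a2\<close> and from \<open>a2\<close> to \<open>a\<close>.\<close>
  have a2_nz: "a \<noteq> \<zero>" if "a2 \<noteq> \<zero>" using that a by (auto simp: a2)
  have a3_nz: "a2 \<noteq> \<zero>" if "a3 \<noteq> \<zero>" using that a by (auto simp: a3)
  have left_min: "left_series A m \<noteq> {\<zero>}" if "a2 \<noteq> \<zero>" "0 < m" "m < 3" for m
  proof -
    from that(2,3) have "m = 1 \<or> m = 2" by linarith
    then show ?thesis using mem(4,5) that(1) a2_nz by (metis singletonD)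
  qed
  have right_min: "right_series A m \<noteq> {\<zero>}" if "a2 \<noteq> \<zero>" "0 < m" "m < 3" for m
  proof -
    from that(2,3) have "m = 1 \<or> m = 2" by linarith
    then show ?thesis using mem(1,2) that(1) a2_nz by (metis singletonD)
  qed
  have right_min': "right_series A m \<noteq> {\<zero>}" if "a3 \<noteq> \<zero>" "0 < m" "m < 4" for m
  proof (cases "m = 3")
    case True
    then show ?thesis using mem(3) that(1) by (metis singletonD)
  next
    case False
    with that(2,3) have "m < 3" by linarith
    with right_min[OF a3_nz[OF that(1)] that(2)] show ?thesis by blast
  qed
  have all_star: "comb a k1 k2 k3 \<star> comb a t1 t2 t3 =
      add_pow A (t1 * k1) a2 \<oplus> add_pow A ((2 * k2 + k1 - k1\<^sup>2) div 2 * t1) a3"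
    for k1 k2 k3 t1 t2 t3
    using comb_star_comb[OF a] comb0 by simp
  show ?thesis
  proof (intro conjI impI ballI allI)
    fix x assume "x \<in> carrier A"
    then show "\<exists>(k1::int) (k2::int) (k3::int). x = add_pow A k1 a1 \<oplus> add_pow A k2 a2 \<oplus> add_pow A k3 a3"
      unfolding comb3 by (rule span)
  next
    fix x y and k1 k2 k3 t1 t2 t3 :: int
    assume xy: "x = add_pow A k1 a1 \<oplus> add_pow A k2 a2 \<oplus> add_pow A k3 a3"
      "y = add_pow A t1 a1 \<oplus> add_pow A t2 a2 \<oplus> add_pow A t3 a3"
    show "x \<star> y = add_pow A (t1 * k1) a2 \<oplus> add_pow A ((2 * k2 + k1 - k1\<^sup>2) div 2 * t1) a3"
      unfolding xy comb3 by (rule all_star)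
    show "x \<otimes> y = add_pow A (k1 + t1) a1 \<oplus> add_pow A (k2 + t2 + t1 * k1) a2
        \<oplus> add_pow A (k3 + t3 + (2 * k2 + k1 - k1\<^sup>2) div 2 * t1) a3"
      unfolding xy comb3 by (rule comb_mult_comb[OF a])
  next
    fix x assume "a3 = \<zero>" "x \<in> carrier A"
    then show "\<exists>(k1::int) (k2::int). x = add_pow A k1 a1 \<oplus> add_pow A k2 a2"
      using span[of x] comb2 by blast
  next
    fix x y and k1 k2 t1 t2 :: int
    assume z: "a3 = \<zero>" and xy: "x = add_pow A k1 a1 \<oplus> add_pow A k2 a2"
      "y = add_pow A t1 a1 \<oplus> add_pow A t2 a2"
    \<comment> \<open>Any third coefficient represents the same element when
      \<open>a3 = \<zero>\<close>; 0 is chosen.\<close>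
    have xy': "x = comb a k1 k2 0" "y = comb a t1 t2 0" by (simp_all only: xy comb2[OF z])
    show "x \<star> y = add_pow A (t1 * k1) a2"
      unfolding xy' all_star using closed by (simp add: z)
    show "x \<otimes> y = add_pow A (k1 + t1) a1 \<oplus> add_pow A (k2 + t2 + t1 * k1) a2"
      unfolding xy' comb_mult_comb[OF a] by (rule comb2[OF z])
  next
    \<comment> \<open>The pair 4, 3 serves both cases, since nilpotency asks for no
      minimality.\<close>
    show "smoktunowicz_nilpotent A"
      unfolding smoktunowicz_nilpotent_def
      by (rule exI[of _ 4], rule exI[of _ 3]) (simp only: right4 A3, simp)
  next
    assume "a3 = \<zero>"
    then show "right_series A 3 = {\<zero>}" by (rule right3)
  next
    show "left_series A 3 = {\<zero>}" by (rule A3)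
  next
    \<comment> \<open>If \<open>a2\<close> were zero, all star products would vanish and both series
      would reach zero by index 2; \<open>a2 \<noteq> \<zero>\<close> is what makes 3
      minimal.\<close>
    assume "a3 = \<zero> \<and> a2 \<noteq> \<zero>"
    then show "A \<in> \<N>\<^sub>S 3 3"
      unfolding smoktunowicz_class_def mem_Collect_eq
      by (intro conjI allI impI brace right3 A3 left_min right_min; simp)
  next
    assume "a3 \<noteq> \<zero>"
    then show "A \<in> \<N>\<^sub>S 4 3"
      unfolding smoktunowicz_class_def mem_Collect_eq
      by (intro conjI allI impI brace right4 A3 left_min[OF a3_nz] right_min'; simp)
  qed
qed

end
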